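(* Let $n\ge 2$ be an even integer, $h=1/n$, $\theta_1,\theta_2\in(0,1]$, $\lambda>0$, $g_a,g_b\in\mathbb{R}$, and let $f$ be a source term on $\Omega=(a,b)$, where $a=(1-\theta_1)h$ and $b=1-(1-\theta_2)h$. Let $A_h\in\mathbb{R}^{(n+1)\times(n+1)}$ and $\boldsymbol{F}_h\in\mathbb{R}^{n+1}$ be the one-dimensional ghost finite element matrix and right-hand side (Dirichlet condition at $a$, Neumann condition at $b$) defined in the context, and let $\mathcal{I}^h_{2h}\in\mathbb{R}^{(n/2+1)\times(n+1)}$ be the restriction matrix defined in the context. For every vector $\hat{\boldsymbol{u}}_h\in\mathbb{R}^{n+1}$, let $\boldsymbol{r}_h=\boldsymbol{F}_h-A_h\hat{\boldsymbol{u}}_h$ be the fine-grid residual, let $\boldsymbol{r}_{2h}=\mathcal{I}^h_{2h}\boldsymbol{r}_h$ be its standard (non-splitting) restriction to the coarse grid, and let $$\boldsymbol{r}^{\mathrm{SPLIT}}_{2h}=\mathcal{I}^h_{2h}\boldsymbol{r}^I_h+\boldsymbol{r}^B_{2h}+\boldsymbol{r}^\lambda_{2h}+\boldsymbol{r}^N_{2h}$$ be the coarse-grid residual obtained by the splitting strategy, where $\boldsymbol{r}^I_h,\boldsymbol{r}^B_{2h},\boldsymbol{r}^\lambda_{2h},\boldsymbol{r}^N_{2h}$ are defined in the context. Then the splitting and the standard strategies are equivalent, namely $$\boldsymbol{r}^{\mathrm{SPLIT}}_{2h}=\boldsymbol{r}_{2h}.$$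
   Context: Fine grid: nodes $x_i=ih$, $i=0,\dots,n$, on $[0,1]$. The shape functions $\varphi_0,\dots,\varphi_n$ are the continuous piecewise linear hat functions on $[0,1]$ with $\varphi_i(x_j)=\delta_{ij}$, i.e. $\varphi_i(x)=\max(0,1-|x-x_i|/h)$. Derivatives at $a\in[x_0,x_1)$ and at $b\in(x_{n-1},x_n]$ denote the constant slopes on the cells $[x_0,x_1]$ and $[x_{n-1},x_n]$ respectively. Thus $\varphi_0(a)=\theta_1$, $\varphi_1(a)=1-\theta_1$, $\varphi_0'(a)=-1/h$, $\varphi_1'(a)=1/h$, $\varphi_{n-1}(b)=1-\theta_2$, $\varphi_n(b)=\theta_2$, $\varphi_{n-1}'(b)=-1/h$, $\varphi_n'(b)=1/h$, and all other values and slopes of shape functions at $a$ and at $b$ vanish. All vectors and matrices are indexed from $0$. Fine-grid matrices ($i,j=0,\dots,n$): - $(A_h^I)_{ij}=\int_a^b\varphi_i'(x)\varphi_j'(x)\,dx$ (stiffness matrix; tridiagonal, with the two cut cells $[x_0,x_1]$ and $[x_{n-1},x_n]$ contributing with weights $\theta_1$ and $\theta_2$); - $(A_h^B)_{ij}=\varphi_i(a)\varphi_j'(a)$, i.e. the only nonzero block is $\frac1h\begin{pmatrix}-\theta_1&\theta_1\\ \theta_1-1&1-\theta_1\end{pmatrix}$ in rows and columns $0,1$; - $(A_h^\lambda)_{ij}=\lambda\,\varphi_i(a)\varphi_j(a)$, i.e. the only nonzero block is $\lambda\begin{pmatrix}\theta_1^2&\theta_1(1-\theta_1)\\ \theta_1(1-\theta_1)&(1-\theta_1)^2\end{pmatrix}$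 in rows and columns $0,1$; - $(A_h^{B,N})_{ij}=-\varphi_i(b)\varphi_j'(b)$, i.e. the only nonzero block is $\frac1h\begin{pmatrix}1-\theta_2&\theta_2-1\\ \theta_2&-\theta_2\end{pmatrix}$ in rows and columns $n-1,n$. The ghost finite element matrix is $A_h=A_h^I+A_h^B+(A_h^B)^T+A_h^\lambda$. Right-hand side: $\boldsymbol{F}_h=\boldsymbol{F}_h^I+\boldsymbol{F}_h^B+\boldsymbol{F}_h^\lambda+\boldsymbol{F}_h^N$, where - $\boldsymbol{F}^I_h=(\tilde f_0,\dots,\tilde f_n)^T$ with $\tilde f_i=\int_a^b f\varphi_i\,dx$ ($f$ is assumed to be such that these are well-defined real numbers); - $\boldsymbol{F}^B_h=\frac1h(-g_a,\,g_a,\,0,\dots,0)^T$; - $\boldsymbol{F}^\lambda_h=\lambda(\theta_1g_a,\,(1-\theta_1)g_a,\,0,\dots,0)^T$; - $\boldsymbol{F}^N_h=(0,\dots,0,\,(1-\theta_2)g_b,\,\theta_2g_b)^T$. Restriction matrix ($i=0,\dots,n/2$, $k=0,\dots,n$): $(\mathcal{I}^h_{2h})_{i,k}=1$ if $k=2i$, $=\tfrac12$ if $|k-2i|=1$, and $=0$ otherwise. Residual components for the splitting strategy. Given $\hat{\boldsymbol{u}}_h=(\hat u_0,\dots,\hat u_n)^T$, let $\hat u=\sum_{i=0}^n\hat u_i\varphi_i$ and put $r_a=g_a-\hat u(a)$, $r_b=g_b-\hat u'(b)$. Then - $\boldsymbol{r}^I_h=\boldsymbol{F}^I_h-A^I_h\hat{\boldsymbol{u}}_h-A^B_h\hat{\boldsymbol{u}}_h-A^{B,N}_h\hat{\boldsymbol{u}}_h\in\mathbb{R}^{n+1}$;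 - $\boldsymbol{r}^B_{2h}=\frac{1}{2h}(-r_a,\,r_a,\,0,\dots,0)^T\in\mathbb{R}^{n/2+1}$; - $\boldsymbol{r}^\lambda_{2h}=\frac{\lambda}{2}\big((1+\theta_1)r_a,\,(1-\theta_1)r_a,\,0,\dots,0\big)^T\in\mathbb{R}^{n/2+1}$ (same $\lambda$ as on the fine grid); - $\boldsymbol{r}^N_{2h}=\frac12\big(0,\dots,0,\,(1-\theta_2)r_b,\,(1+\theta_2)r_b\big)^T\in\mathbb{R}^{n/2+1}$. The last three are the boundary residual vectors of the coarse grid of step $2h$, for which the cut fractions are $(1+\theta_1)/2$ and $(1+\theta_2)/2$. *)

theory Defs
  imports
    "HOL-Analysis.Henstock_Kurzweil_Integration"
    "Jordan_Normal_Form.Matrix"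
begin

unbundle no vec_syntax

section \<open>Grid and shape functions\<close>

definition step :: "nat \<Rightarrow> real" where
  "step n = 1 / real n"

definition node :: "nat \<Rightarrow> nat \<Rightarrow> real" where
  "node n i = real i * step n"

definition left_end :: "nat \<Rightarrow> real \<Rightarrow> real" where
  "left_end n \<theta>\<^sub>1 = (1 - \<theta>\<^sub>1) * step n"

definition right_end :: "nat \<Rightarrow> real \<Rightarrow> real" where
  "right_end n \<theta>\<^sub>2 = 1 - (1 - \<theta>\<^sub>2) * step n"

definition hat :: "nat \<Rightarrow> nat \<Rightarrow> real \<Rightarrow> real" where
  "hat n i x = max 0 (1 - \<bar>x - node n i\<bar> / step n)"

text \<open>The derivative at the left end is taken within the first cell, the one at the right end
  within the last cell. Hence it is the slope on that cell even if the boundary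
  point is a node, that is, a kink of a shape function (\<open>\<theta>\<^sub>1 = 1\<close> or \<open>\<theta>\<^sub>2 = 1\<close>).\<close>

definition deriv_left :: "nat \<Rightarrow> real \<Rightarrow> (real \<Rightarrow> real) \<Rightarrow> real" where
  "deriv_left n \<theta>\<^sub>1 g =
     vector_derivative g (at (left_end n \<theta>\<^sub>1) within {node n 0..node n 1})"

definition deriv_right :: "nat \<Rightarrow> real \<Rightarrow> (real \<Rightarrow> real) \<Rightarrow> real" where
  "deriv_right n \<theta>\<^sub>2 g =
     vector_derivative g (at (right_end n \<theta>\<^sub>2) within {node n (n - 1)..node n n})"

definition fe_fun :: "nat \<Rightarrow> real vec \<Rightarrow> real \<Rightarrow> real" where
  "fe_fun n u x = (\<Sum>i\<le>n. u $ i * hat n i x)"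

section \<open>Fine-grid matrix and right-hand side\<close>

text \<open>Integrals over \<open>(a, b)\<close> are Henstock--Kurzweil integrals; they agree with the Lebesgue integral
  of every Lebesgue integrable integrand. At the finitely many nodes, \<open>deriv (hat n i)\<close> may be an unspecified number; this
  does not affect the integral.\<close>

definition A_I :: "nat \<Rightarrow> real \<Rightarrow> real \<Rightarrow> real mat" where
  "A_I n \<theta>\<^sub>1 \<theta>\<^sub>2 = mat (n + 1) (n + 1) (\<lambda>(i, j).
     integral {left_end n \<theta>\<^sub>1<..<right_end n \<theta>\<^sub>2} (\<lambda>x. deriv (hat n i) x * deriv (hat n j) x))"

definition A_B :: "nat \<Rightarrow> real \<Rightarrow> real mat" where
  "A_B n \<theta>\<^sub>1 = mat (n + 1) (n + 1) (\<lambda>(i, j).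
     hat n i (left_end n \<theta>\<^sub>1) * deriv_left n \<theta>\<^sub>1 (hat n j))"

definition A_pen :: "nat \<Rightarrow> real \<Rightarrow> real \<Rightarrow> real mat" where
  "A_pen n \<theta>\<^sub>1 lam = mat (n + 1) (n + 1) (\<lambda>(i, j).
     lam * hat n i (left_end n \<theta>\<^sub>1) * hat n j (left_end n \<theta>\<^sub>1))"

definition A_BN :: "nat \<Rightarrow> real \<Rightarrow> real mat" where
  "A_BN n \<theta>\<^sub>2 = mat (n + 1) (n + 1) (\<lambda>(i, j).
     - (hat n i (right_end n \<theta>\<^sub>2) * deriv_right n \<theta>\<^sub>2 (hat n j)))"

definition ghost_matrix :: "nat \<Rightarrow> real \<Rightarrow> real \<Rightarrow> real \<Rightarrow> real mat" where
  "ghost_matrix n \<theta>\<^sub>1 \<theta>\<^sub>2 lam =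
     A_I n \<theta>\<^sub>1 \<theta>\<^sub>2 + A_B n \<theta>\<^sub>1 + transpose_mat (A_B n \<theta>\<^sub>1) + A_pen n \<theta>\<^sub>1 lam"

definition F_I :: "nat \<Rightarrow> real \<Rightarrow> real \<Rightarrow> (real \<Rightarrow> real) \<Rightarrow> real vec" where
  "F_I n \<theta>\<^sub>1 \<theta>\<^sub>2 f = vec (n + 1) (\<lambda>i.
     integral {left_end n \<theta>\<^sub>1<..<right_end n \<theta>\<^sub>2} (\<lambda>x. f x * hat n i x))"

definition F_B :: "nat \<Rightarrow> real \<Rightarrow> real vec" where
  "F_B n g\<^sub>a = (1 / step n) \<cdot>\<^sub>v vec (n + 1) (\<lambda>i.
     if i = 0 then - g\<^sub>a else if i = 1 then g\<^sub>a else 0)"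

definition F_pen :: "nat \<Rightarrow> real \<Rightarrow> real \<Rightarrow> real \<Rightarrow> real vec" where
  "F_pen n \<theta>\<^sub>1 lam g\<^sub>a = lam \<cdot>\<^sub>v vec (n + 1) (\<lambda>i.
     if i = 0 then \<theta>\<^sub>1 * g\<^sub>a else if i = 1 then (1 - \<theta>\<^sub>1) * g\<^sub>a else 0)"

definition F_N :: "nat \<Rightarrow> real \<Rightarrow> real \<Rightarrow> real vec" where
  "F_N n \<theta>\<^sub>2 g\<^sub>b = vec (n + 1) (\<lambda>i.
     if i = n - 1 then (1 - \<theta>\<^sub>2) * g\<^sub>b else if i = n then \<theta>\<^sub>2 * g\<^sub>b else 0)"

definition ghost_rhs ::
  "nat \<Rightarrow> real \<Rightarrow> real \<Rightarrow> real \<Rightarrow> real \<Rightarrow> real \<Rightarrow> (real \<Rightarrow> real) \<Rightarrow> real vec" where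
  "ghost_rhs n \<theta>\<^sub>1 \<theta>\<^sub>2 lam g\<^sub>a g\<^sub>b f =
     F_I n \<theta>\<^sub>1 \<theta>\<^sub>2 f + F_B n g\<^sub>a + F_pen n \<theta>\<^sub>1 lam g\<^sub>a + F_N n \<theta>\<^sub>2 g\<^sub>b"

definition fine_residual ::
  "nat \<Rightarrow> real \<Rightarrow> real \<Rightarrow> real \<Rightarrow> real \<Rightarrow> real \<Rightarrow> (real \<Rightarrow> real) \<Rightarrow> real vec \<Rightarrow> real vec" where
  "fine_residual n \<theta>\<^sub>1 \<theta>\<^sub>2 lam g\<^sub>a g\<^sub>b f u =
     ghost_rhs n \<theta>\<^sub>1 \<theta>\<^sub>2 lam g\<^sub>a g\<^sub>b f - ghost_matrix n \<theta>\<^sub>1 \<theta>\<^sub>2 lam *\<^sub>v u"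

section \<open>Restriction to the coarse grid\<close>

definition restriction :: "nat \<Rightarrow> real mat" where
  "restriction n = mat (n div 2 + 1) (n + 1) (\<lambda>(i, k).
     if k = 2 * i then 1 else if \<bar>int k - 2 * int i\<bar> = 1 then 1 / 2 else 0)"

definition standard_coarse_residual ::
  "nat \<Rightarrow> real \<Rightarrow> real \<Rightarrow> real \<Rightarrow> real \<Rightarrow> real \<Rightarrow> (real \<Rightarrow> real) \<Rightarrow> real vec \<Rightarrow> real vec" where
  "standard_coarse_residual n \<theta>\<^sub>1 \<theta>\<^sub>2 lam g\<^sub>a g\<^sub>b f u =
     restriction n *\<^sub>v fine_residual n \<theta>\<^sub>1 \<theta>\<^sub>2 lam g\<^sub>a g\<^sub>b f u"

section \<open>Splitting strategy\<close>

definition res_a :: "nat \<Rightarrow> real \<Rightarrow> real \<Rightarrow> real vec \<Rightarrow> real" where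
  "res_a n \<theta>\<^sub>1 g\<^sub>a u = g\<^sub>a - fe_fun n u (left_end n \<theta>\<^sub>1)"

definition res_b :: "nat \<Rightarrow> real \<Rightarrow> real \<Rightarrow> real vec \<Rightarrow> real" where
  "res_b n \<theta>\<^sub>2 g\<^sub>b u = g\<^sub>b - deriv_right n \<theta>\<^sub>2 (fe_fun n u)"

definition r_I :: "nat \<Rightarrow> real \<Rightarrow> real \<Rightarrow> (real \<Rightarrow> real) \<Rightarrow> real vec \<Rightarrow> real vec" where
  "r_I n \<theta>\<^sub>1 \<theta>\<^sub>2 f u =
     F_I n \<theta>\<^sub>1 \<theta>\<^sub>2 f - A_I n \<theta>\<^sub>1 \<theta>\<^sub>2 *\<^sub>v u - A_B n \<theta>\<^sub>1 *\<^sub>v u - A_BN n \<theta>\<^sub>2 *\<^sub>v u"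

definition r_B_coarse :: "nat \<Rightarrow> real \<Rightarrow> real \<Rightarrow> real vec \<Rightarrow> real vec" where
  "r_B_coarse n \<theta>\<^sub>1 g\<^sub>a u = (1 / (2 * step n)) \<cdot>\<^sub>v vec (n div 2 + 1) (\<lambda>i.
     if i = 0 then - res_a n \<theta>\<^sub>1 g\<^sub>a u else if i = 1 then res_a n \<theta>\<^sub>1 g\<^sub>a u else 0)"

definition r_pen_coarse :: "nat \<Rightarrow> real \<Rightarrow> real \<Rightarrow> real \<Rightarrow> real vec \<Rightarrow> real vec" where
  "r_pen_coarse n \<theta>\<^sub>1 lam g\<^sub>a u = (lam / 2) \<cdot>\<^sub>v vec (n div 2 + 1) (\<lambda>i.
     if i = 0 then (1 + \<theta>\<^sub>1) * res_a n \<theta>\<^sub>1 g\<^sub>a u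
     else if i = 1 then (1 - \<theta>\<^sub>1) * res_a n \<theta>\<^sub>1 g\<^sub>a u else 0)"

definition r_N_coarse :: "nat \<Rightarrow> real \<Rightarrow> real \<Rightarrow> real vec \<Rightarrow> real vec" where
  "r_N_coarse n \<theta>\<^sub>2 g\<^sub>b u = (1 / 2) \<cdot>\<^sub>v vec (n div 2 + 1) (\<lambda>i.
     if i = n div 2 - 1 then (1 - \<theta>\<^sub>2) * res_b n \<theta>\<^sub>2 g\<^sub>b u
     else if i = n div 2 then (1 + \<theta>\<^sub>2) * res_b n \<theta>\<^sub>2 g\<^sub>b u else 0)"

definition split_coarse_residual ::
  "nat \<Rightarrow> real \<Rightarrow> real \<Rightarrow> real \<Rightarrow> real \<Rightarrow> real \<Rightarrow> (real \<Rightarrow> real) \<Rightarrow> real vec \<Rightarrow> real vec" where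
  "split_coarse_residual n \<theta>\<^sub>1 \<theta>\<^sub>2 lam g\<^sub>a g\<^sub>b f u =
     restriction n *\<^sub>v r_I n \<theta>\<^sub>1 \<theta>\<^sub>2 f u + r_B_coarse n \<theta>\<^sub>1 g\<^sub>a u
     + r_pen_coarse n \<theta>\<^sub>1 lam g\<^sub>a u + r_N_coarse n \<theta>\<^sub>2 g\<^sub>b u"

end

theory Submission imports Defs begin

text \<open>With \<open>\<phi>\<^sub>i = hat n i\<close>, the boundary terms of the fine residual combine by linearity into
  \<open>r\<^sub>a \<phi>\<^sub>i'(a) + \<lambda> r\<^sub>a \<phi>\<^sub>i(a) + r\<^sub>b \<phi>\<^sub>i(b)\<close>, once the Neumann flux matrix is added and subtracted.
  Each of these three vectors is supported on two neighbouring nodes of a boundary cell, so its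
  restriction is a two-term sum, which is the corresponding coarse-grid vector.\<close>

section \<open>Hat functions and their slopes on one closed cell\<close>

lemma step_pos: "0 < n \<Longrightarrow> 0 < step n"
  by (simp add: step_def)

text \<open>In the coordinate \<open>t = x / step n\<close> the cell is [k, k+1]. Every node other
  than k and k+1 is at distance at least 1 from t, so the maximum in \<open>hat\<close> is 0 there.
  Taking the cell closed covers boundary points that are themselves nodes.\<close>

lemma hat_on_cell:
  assumes n: "0 < n" and x: "x \<in> {node n k..node n (k + 1)}"
  shows "hat n i x = (if i = k then 1 - (x / step n - real k)
    else if i = k + 1 then x / step n - real k else 0)"
proof -
  define t where "t = x / step n"
  note h = step_pos[OF n]
  have t: "real k \<le> t" "t \<le> real k + 1"
    using x h by (auto simp: t_def node_def field_simps)
  have "\<bar>x - node n i\<bar> / step n = \<bar>(x - node n i) / step n\<bar>"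
    using h by simp
  also have "(x - node n i) / step n = t - real i"
    using h by (simp add: t_def node_def field_simps)
  finally have hat: "hat n i x = max 0 (1 - \<bar>t - real i\<bar>)"
    by (simp add: hat_def)
  consider "i = k" | "i = k + 1" | "real i + 1 \<le> real k" | "real i \<ge> real k + 2"
    by linarith
  then show ?thesis
    unfolding hat t_def[symmetric] using t by cases auto
qed

text \<open>Relative to the closed cell the hat coincides with an affine function, so its slope
  exists even at the end nodes, where the two-sided derivative may fail to exist.\<close>

lemma hat_has_vector_derivative_on_cell:
  assumes n: "0 < n" and x: "x \<in> {node n k..node n (k + 1)}"
  shows "(hat n i has_vector_derivative
    (if i = k then - (1 / step n) else if i = k + 1 then 1 / step n else 0))
    (at x within {node n k..node n (k + 1)})"
proof (rule has_vector_derivative_transform[OF x])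
  show "hat n i y = (if i = k then 1 - (y / step n - real k)
      else if i = k + 1 then y / step n - real k else 0)"
    if "y \<in> {node n k..node n (k + 1)}" for y
    using hat_on_cell[OF n that] .
  show "((\<lambda>y. if i = k then 1 - (y / step n - real k)
      else if i = k + 1 then y / step n - real k else 0) has_vector_derivative
    (if i = k then - (1 / step n) else if i = k + 1 then 1 / step n else 0))
    (at x within {node n k..node n (k + 1)})"
    using step_pos[OF n]
    by (auto simp: has_real_derivative_iff_has_vector_derivative[symmetric]
        intro!: derivative_eq_intros)
qed

text \<open>The cell has positive length, so derivatives within it are unique and the choice made by
  \<open>vector_derivative\<close> must be D.\<close>

lemma vector_derivative_on_cell:
  fixes g :: "real \<Rightarrow> real"
  assumes n: "0 < n" and x: "x \<in> {node n k..node n (k + 1)}"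
    and D: "(g has_vector_derivative D) (at x within {node n k..node n (k + 1)})"
  shows "vector_derivative g (at x within {node n k..node n (k + 1)}) = D"
  using vector_derivative_within_closed_interval[OF _ x D] step_pos[OF n]
  by (simp add: node_def algebra_simps)

section \<open>Values and slopes at the two boundary points\<close>

lemma left_end_in_cell:
  assumes "0 < n" "0 < \<theta>" "\<theta> \<le> 1"
  shows "left_end n \<theta> \<in> {node n 0..node n (0 + 1)}"
  using step_pos[OF assms(1)] assms by (auto simp: left_end_def node_def)

text \<open>The bound \<open>n - 1 + 1\<close> keeps the shape \<open>k + 1\<close> of the cell
  lemmas with k = n - 1; it equals n because n is positive.\<close>

lemma right_end_in_cell:
  assumes "0 < n" "0 < \<theta>" "\<theta> \<le> 1"
  shows "right_end n \<theta> \<in> {node n (n - 1)..node n (n - 1 + 1)}"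
  using assms by (auto simp: right_end_def node_def step_def field_simps)

lemma hat_left_end:
  assumes "0 < n" "0 < \<theta>" "\<theta> \<le> 1"
  shows "hat n i (left_end n \<theta>) = (if i = 0 then \<theta> else if i = 1 then 1 - \<theta> else 0)"
  using hat_on_cell[OF assms(1) left_end_in_cell[OF assms], of i] step_pos[OF assms(1)]
  by (simp add: left_end_def)

lemma hat_right_end:
  assumes "0 < n" "0 < \<theta>" "\<theta> \<le> 1"
  shows "hat n i (right_end n \<theta>) = (if i = n - 1 then 1 - \<theta> else if i = n then \<theta> else 0)"
proof -
  have "right_end n \<theta> / step n = real n - (1 - \<theta>)"
    using assms by (simp add: right_end_def step_def field_simps)
  then show ?thesis
    using hat_on_cell[OF assms(1) right_end_in_cell[OF assms], of i] assms(1)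
    by (simp add: of_nat_diff)
qed

lemma deriv_left_hat:
  assumes "0 < n" "0 < \<theta>" "\<theta> \<le> 1"
  shows "deriv_left n \<theta> (hat n i) =
    (if i = 0 then - (1 / step n) else if i = 1 then 1 / step n else 0)"
  using vector_derivative_on_cell[OF assms(1) left_end_in_cell[OF assms]
      hat_has_vector_derivative_on_cell[OF assms(1) left_end_in_cell[OF assms]], of i]
  by (simp add: deriv_left_def)

text \<open>Linearity of \<open>vector_derivative\<close>, a choice operator, requires the
  derivatives to exist. Within the last cell every hat is affine, so the slopes exist and add up,
  also when b is the node n.\<close>

lemma deriv_right_fe_fun:
  assumes "0 < n" "0 < \<theta>" "\<theta> \<le> 1"
  shows "deriv_right n \<theta> (fe_fun n u) = (\<Sum>j\<le>n. u $ j * deriv_right n \<theta> (hat n j))"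
proof -
  let ?b = "right_end n \<theta>" and ?C = "{node n (n - 1)..node n (n - 1 + 1)}"
  note b = right_end_in_cell[OF assms]
  have D: "(hat n j has_vector_derivative deriv_right n \<theta> (hat n j)) (at ?b within ?C)" for j
    using hat_has_vector_derivative_on_cell[OF assms(1) b, of j]
      vector_derivative_on_cell[OF assms(1) b
        hat_has_vector_derivative_on_cell[OF assms(1) b, of j]] assms(1)
    by (simp add: deriv_right_def)
  have "(fe_fun n u has_vector_derivative (\<Sum>j\<le>n. u $ j * deriv_right n \<theta> (hat n j)))
      (at ?b within ?C)"
    unfolding fe_fun_def[abs_def]
    by (intro has_vector_derivative_sum has_vector_derivative_mult_right D)
  from vector_derivative_on_cell[OF assms(1) b this] show ?thesis
    using assms(1) by (simp add: deriv_right_def)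
qed

section \<open>Splitting the fine residual\<close>

definition boundary_residual ::
  "nat \<Rightarrow> real \<Rightarrow> real \<Rightarrow> real \<Rightarrow> real \<Rightarrow> real \<Rightarrow> real vec \<Rightarrow> real vec" where
  "boundary_residual n \<theta>\<^sub>1 \<theta>\<^sub>2 lam g\<^sub>a g\<^sub>b u = vec (n + 1) (\<lambda>k.
     deriv_left n \<theta>\<^sub>1 (hat n k) * res_a n \<theta>\<^sub>1 g\<^sub>a u
     + lam * hat n k (left_end n \<theta>\<^sub>1) * res_a n \<theta>\<^sub>1 g\<^sub>a u
     + hat n k (right_end n \<theta>\<^sub>2) * res_b n \<theta>\<^sub>2 g\<^sub>b u)"

text \<open>No integral is evaluated: \<open>F_I\<close>, \<open>A_I\<close> and \<open>A_B\<close>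
  enter both sides identically and cancel. Writing \<open>boundary_residual\<close> with values and
  slopes of hats makes the remaining terms match by linearity alone.\<close>

lemma fine_residual_eq:
  assumes n: "0 < n" and \<theta>\<^sub>1: "0 < \<theta>\<^sub>1" "\<theta>\<^sub>1 \<le> 1" and \<theta>\<^sub>2: "0 < \<theta>\<^sub>2" "\<theta>\<^sub>2 \<le> 1"
    and u: "u \<in> carrier_vec (n + 1)"
  shows "fine_residual n \<theta>\<^sub>1 \<theta>\<^sub>2 lam g\<^sub>a g\<^sub>b f u =
    r_I n \<theta>\<^sub>1 \<theta>\<^sub>2 f u + boundary_residual n \<theta>\<^sub>1 \<theta>\<^sub>2 lam g\<^sub>a g\<^sub>b u"
proof (rule eq_vecI)
  have dims: "A_I n \<theta>\<^sub>1 \<theta>\<^sub>2 \<in> carrier_mat (n + 1) (n + 1)"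
    "A_B n \<theta>\<^sub>1 \<in> carrier_mat (n + 1) (n + 1)"
    "(A_B n \<theta>\<^sub>1)\<^sup>T \<in> carrier_mat (n + 1) (n + 1)"
    "A_pen n \<theta>\<^sub>1 lam \<in> carrier_mat (n + 1) (n + 1)"
    "A_BN n \<theta>\<^sub>2 \<in> carrier_mat (n + 1) (n + 1)"
    by (simp_all add: A_I_def A_B_def A_pen_def A_BN_def)
  have vdims: "F_I n \<theta>\<^sub>1 \<theta>\<^sub>2 f \<in> carrier_vec (n + 1)"
    "F_B n g\<^sub>a \<in> carrier_vec (n + 1)"
    "F_pen n \<theta>\<^sub>1 lam g\<^sub>a \<in> carrier_vec (n + 1)"
    "F_N n \<theta>\<^sub>2 g\<^sub>b \<in> carrier_vec (n + 1)"
    by (simp_all add: F_I_def F_B_def F_pen_def F_N_def)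
  note carr = dims[THEN carrier_matD(1)] dims[THEN carrier_matD(2)] vdims[THEN carrier_vecD]
  \<comment> \<open>A sum or difference of vectors takes its dimension from the second operand, so
    only the last term has to be inspected.\<close>
  show "dim_vec (fine_residual n \<theta>\<^sub>1 \<theta>\<^sub>2 lam g\<^sub>a g\<^sub>b f u) =
      dim_vec (r_I n \<theta>\<^sub>1 \<theta>\<^sub>2 f u + boundary_residual n \<theta>\<^sub>1 \<theta>\<^sub>2 lam g\<^sub>a g\<^sub>b u)"
    by (simp add: fine_residual_def ghost_matrix_def boundary_residual_def carr)
  fix i assume "i < dim_vec (r_I n \<theta>\<^sub>1 \<theta>\<^sub>2 f u + boundary_residual n \<theta>\<^sub>1 \<theta>\<^sub>2 lam g\<^sub>a g\<^sub>b u)"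
  then have i: "i < n + 1"
    by (simp add: boundary_residual_def)
  let ?a = "left_end n \<theta>\<^sub>1" and ?b = "right_end n \<theta>\<^sub>2"
  have matvec: "(A_I n \<theta>\<^sub>1 \<theta>\<^sub>2 + A_B n \<theta>\<^sub>1 + (A_B n \<theta>\<^sub>1)\<^sup>T + A_pen n \<theta>\<^sub>1 lam) *\<^sub>v u
      = A_I n \<theta>\<^sub>1 \<theta>\<^sub>2 *\<^sub>v u + A_B n \<theta>\<^sub>1 *\<^sub>v u + (A_B n \<theta>\<^sub>1)\<^sup>T *\<^sub>v u + A_pen n \<theta>\<^sub>1 lam *\<^sub>v u"
    using u dims by (simp add: add_mult_distrib_mat_vec[of _ "Suc n" "Suc n"]
        assoc_add_vec[of _ "Suc n"] mult_mat_vec_carrier[of _ "Suc n" "Suc n"])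
  \<comment> \<open>Transposing puts the slope on the row index: row i is the slope of hat i at a
    times the values of all hats at a, which sum against u to the value of \<open>fe_fun\<close> at
    a.\<close>
  have AT: "((A_B n \<theta>\<^sub>1)\<^sup>T *\<^sub>v u) $ i = deriv_left n \<theta>\<^sub>1 (hat n i) * fe_fun n u ?a"
    using i u
    by (auto simp: A_B_def fe_fun_def scalar_prod_def sum_distrib_left algebra_simps
        lessThan_Suc_atMost atLeast0LessThan intro!: sum.cong)
  have AP: "(A_pen n \<theta>\<^sub>1 lam *\<^sub>v u) $ i = lam * hat n i ?a * fe_fun n u ?a"
    using i u
    by (auto simp: A_pen_def fe_fun_def scalar_prod_def sum_distrib_left algebra_simps
        lessThan_Suc_atMost atLeast0LessThan intro!: sum.cong)
  \<comment> \<open>Because of this sign, subtracting the flux matrix in \<open>r_I\<close> adds hat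
    i at b times the slope of \<open>fe_fun\<close> at b. The term with \<open>res_b\<close> takes
    it away again and leaves the entry of \<open>F_N\<close>.\<close>
  have AN: "(A_BN n \<theta>\<^sub>2 *\<^sub>v u) $ i = - (hat n i ?b * deriv_right n \<theta>\<^sub>2 (fe_fun n u))"
    using i u
    by (auto simp: A_BN_def deriv_right_fe_fun[OF n \<theta>\<^sub>2] scalar_prod_def sum_distrib_left
        algebra_simps lessThan_Suc_atMost atLeast0LessThan simp flip: sum_negf intro!: sum.cong)
  have FB: "F_B n g\<^sub>a $ i = deriv_left n \<theta>\<^sub>1 (hat n i) * g\<^sub>a"
    using i by (simp add: F_B_def deriv_left_hat[OF n \<theta>\<^sub>1])
  have FP: "F_pen n \<theta>\<^sub>1 lam g\<^sub>a $ i = lam * hat n i ?a * g\<^sub>a"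
    using i by (simp add: F_pen_def hat_left_end[OF n \<theta>\<^sub>1])
  have FN: "F_N n \<theta>\<^sub>2 g\<^sub>b $ i = hat n i ?b * g\<^sub>b"
    using i by (simp add: F_N_def hat_right_end[OF n \<theta>\<^sub>2])
  have fine: "fine_residual n \<theta>\<^sub>1 \<theta>\<^sub>2 lam g\<^sub>a g\<^sub>b f u $ i =
      F_I n \<theta>\<^sub>1 \<theta>\<^sub>2 f $ i + F_B n g\<^sub>a $ i + F_pen n \<theta>\<^sub>1 lam g\<^sub>a $ i + F_N n \<theta>\<^sub>2 g\<^sub>b $ i
      - ((A_I n \<theta>\<^sub>1 \<theta>\<^sub>2 *\<^sub>v u) $ i + (A_B n \<theta>\<^sub>1 *\<^sub>v u) $ i + ((A_B n \<theta>\<^sub>1)\<^sup>T *\<^sub>v u) $ i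
        + (A_pen n \<theta>\<^sub>1 lam *\<^sub>v u) $ i)"
    \<comment> \<open>The products stay folded, so that they can later be rewritten as whole entries
      by \<open>AT\<close>, \<open>AP\<close> and \<open>AN\<close>.\<close>
    using i unfolding fine_residual_def ghost_rhs_def ghost_matrix_def matvec
    by (simp add: carr del: index_mult_mat_vec)
  have rI: "r_I n \<theta>\<^sub>1 \<theta>\<^sub>2 f u $ i = F_I n \<theta>\<^sub>1 \<theta>\<^sub>2 f $ i - (A_I n \<theta>\<^sub>1 \<theta>\<^sub>2 *\<^sub>v u) $ i
      - (A_B n \<theta>\<^sub>1 *\<^sub>v u) $ i - (A_BN n \<theta>\<^sub>2 *\<^sub>v u) $ i"
    using i unfolding r_I_def by (simp add: carr del: index_mult_mat_vec)
  have "(r_I n \<theta>\<^sub>1 \<theta>\<^sub>2 f u + boundary_residual n \<theta>\<^sub>1 \<theta>\<^sub>2 lam g\<^sub>a g\<^sub>b u) $ i =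
      r_I n \<theta>\<^sub>1 \<theta>\<^sub>2 f u $ i + deriv_left n \<theta>\<^sub>1 (hat n i) * res_a n \<theta>\<^sub>1 g\<^sub>a u
     + lam * hat n i ?a * res_a n \<theta>\<^sub>1 g\<^sub>a u + hat n i ?b * res_b n \<theta>\<^sub>2 g\<^sub>b u"
    using i by (simp add: boundary_residual_def)
  then show "fine_residual n \<theta>\<^sub>1 \<theta>\<^sub>2 lam g\<^sub>a g\<^sub>b f u $ i =
      (r_I n \<theta>\<^sub>1 \<theta>\<^sub>2 f u + boundary_residual n \<theta>\<^sub>1 \<theta>\<^sub>2 lam g\<^sub>a g\<^sub>b u) $ i"
    unfolding fine rI AT AP AN FB FP FN res_a_def res_b_def by (simp add: algebra_simps)
qed

section \<open>Restriction of the boundary vectors\<close>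

lemma restriction_mult_two_point:
  assumes i: "i < n div 2 + 1" and p: "p < n + 1" and q: "q < n + 1" and "p \<noteq> q"
  shows "(restriction n *\<^sub>v vec (n + 1) (\<lambda>k. if k = p then x else if k = q then y else 0)) $ i
    = restriction n $$ (i, p) * x + restriction n $$ (i, q) * y"
proof -
  have dim: "dim_row (restriction n) = n div 2 + 1" "dim_col (restriction n) = n + 1"
    by (simp_all add: restriction_def)
  let ?s = "\<lambda>k. restriction n $$ (i, k) * (if k = p then x else if k = q then y else 0)"
  have "(restriction n *\<^sub>v vec (n + 1) (\<lambda>k. if k = p then x else if k = q then y else 0)) $ i
      = (\<Sum>k\<in>{0..<n + 1}. ?s k)"
    using i by (auto simp: dim scalar_prod_def simp del: sum.op_ivl_Suc intro!: sum.cong)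
  also have "\<dots> = (\<Sum>k\<in>{p, q}. ?s k)"
    using p q by (intro sum.mono_neutral_right) auto
  finally show ?thesis
    \<comment> \<open>If p and q coincided, the first branch of the conditional would hide
      y.\<close>
    using \<open>p \<noteq> q\<close> by simp
qed

lemma restriction_boundary_residual:
  assumes n: "2 \<le> n" and ev: "even n"
    and \<theta>\<^sub>1: "0 < \<theta>\<^sub>1" "\<theta>\<^sub>1 \<le> 1" and \<theta>\<^sub>2: "0 < \<theta>\<^sub>2" "\<theta>\<^sub>2 \<le> 1"
  shows "restriction n *\<^sub>v boundary_residual n \<theta>\<^sub>1 \<theta>\<^sub>2 lam g\<^sub>a g\<^sub>b u =
    r_B_coarse n \<theta>\<^sub>1 g\<^sub>a u + r_pen_coarse n \<theta>\<^sub>1 lam g\<^sub>a u + r_N_coarse n \<theta>\<^sub>2 g\<^sub>b u"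
proof -
  from n have n0: "0 < n" by simp
  obtain m where m: "n = 2 * m" "0 < m"
    using ev n by (auto elim!: evenE)
  let ?R = "restriction n" and ?ra = "res_a n \<theta>\<^sub>1 g\<^sub>a u" and ?rb = "res_b n \<theta>\<^sub>2 g\<^sub>b u"
  have R: "?R \<in> carrier_mat (n div 2 + 1) (n + 1)"
    by (simp add: restriction_def)
  \<comment> \<open>For n = 2 the node 1 belongs to both boundary cells. Keeping one two-point
    vector per boundary term avoids treating this overlap separately.\<close>
  define v where "v = (\<lambda>p q x y. vec (n + 1)
    (\<lambda>k::nat. if k = p then x else if k = q then (y::real) else 0))"
  have v: "v p q x y \<in> carrier_vec (n + 1)" for p q x y
    by (simp add: v_def)
  have two_point: "(?R *\<^sub>v v p q x y) $ i = ?R $$ (i, p) * x + ?R $$ (i, q) * y"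
    if "i < n div 2 + 1" "p < n + 1" "q < n + 1" "p \<noteq> q" for i p q x y
    unfolding v_def using that by (rule restriction_mult_two_point)
  let ?vB = "v 0 1 (- (1 / step n) * ?ra) (1 / step n * ?ra)"
  let ?vP = "v 0 1 (lam * \<theta>\<^sub>1 * ?ra) (lam * (1 - \<theta>\<^sub>1) * ?ra)"
  let ?vN = "v (n - 1) n ((1 - \<theta>\<^sub>2) * ?rb) (\<theta>\<^sub>2 * ?rb)"
  have "boundary_residual n \<theta>\<^sub>1 \<theta>\<^sub>2 lam g\<^sub>a g\<^sub>b u = ?vB + ?vP + ?vN"
    using n0 by (intro eq_vecI) (simp_all add: boundary_residual_def v_def
        deriv_left_hat[OF n0 \<theta>\<^sub>1] hat_left_end[OF n0 \<theta>\<^sub>1] hat_right_end[OF n0 \<theta>\<^sub>2])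
  then have split: "?R *\<^sub>v boundary_residual n \<theta>\<^sub>1 \<theta>\<^sub>2 lam g\<^sub>a g\<^sub>b u =
      ?R *\<^sub>v ?vB + ?R *\<^sub>v ?vP + ?R *\<^sub>v ?vN"
    using v by (simp add: mult_add_distrib_mat_vec[OF R])
  \<comment> \<open>As n is even, the fine nodes 0 and n are coarse nodes and pass to one row with
    weight 1. The odd nodes 1 and n - 1 lie between two coarse nodes and give 1/2 to each.\<close>
  have entries: "?R $$ (i, 0) = (if i = 0 then 1 else 0)"
    "?R $$ (i, 1) = (if i = 0 \<or> i = 1 then 1 / 2 else 0)"
    "?R $$ (i, n - 1) = (if i = n div 2 - 1 \<or> i = n div 2 then 1 / 2 else 0)"
    "?R $$ (i, n) = (if i = n div 2 then 1 else 0)" if "i < n div 2 + 1" for i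
    using that m by (auto simp: restriction_def)
  have B: "?R *\<^sub>v ?vB = r_B_coarse n \<theta>\<^sub>1 g\<^sub>a u"
  proof (rule eq_vecI)
    fix i assume "i < dim_vec (r_B_coarse n \<theta>\<^sub>1 g\<^sub>a u)"
    then have i: "i < n div 2 + 1" by (simp add: r_B_coarse_def)
    have pq: "0 < n + 1" "1 < n + 1" "(0::nat) \<noteq> 1"
      using n by auto
    \<comment> \<open>With h = \<open>step n\<close>, the coefficient in row 0 is -1/h + 1/(2h) =
      -1/(2h), and row 1 receives 1/(2h).\<close>
    show "(?R *\<^sub>v ?vB) $ i = r_B_coarse n \<theta>\<^sub>1 g\<^sub>a u $ i"
      using i n step_pos[OF n0] unfolding two_point[OF i pq] entries[OF i]
      by (simp add: r_B_coarse_def field_simps)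
  qed (simp add: r_B_coarse_def restriction_def)
  have P: "?R *\<^sub>v ?vP = r_pen_coarse n \<theta>\<^sub>1 lam g\<^sub>a u"
  proof (rule eq_vecI)
    fix i assume "i < dim_vec (r_pen_coarse n \<theta>\<^sub>1 lam g\<^sub>a u)"
    then have i: "i < n div 2 + 1" by (simp add: r_pen_coarse_def)
    have pq: "0 < n + 1" "1 < n + 1" "(0::nat) \<noteq> 1"
      using n by auto
    \<comment> \<open>Row 0 collects \<theta> + (1 - \<theta>)/2 = (1 + \<theta>)/2 with \<theta>
      the left cut fraction, which is the cut fraction on the coarse grid.\<close>
    show "(?R *\<^sub>v ?vP) $ i = r_pen_coarse n \<theta>\<^sub>1 lam g\<^sub>a u $ i"
      using i n unfolding two_point[OF i pq] entries[OF i]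
      by (simp add: r_pen_coarse_def field_simps)
  qed (simp add: r_pen_coarse_def restriction_def)
  have N: "?R *\<^sub>v ?vN = r_N_coarse n \<theta>\<^sub>2 g\<^sub>b u"
  proof (rule eq_vecI)
    fix i assume "i < dim_vec (r_N_coarse n \<theta>\<^sub>2 g\<^sub>b u)"
    then have i: "i < n div 2 + 1" by (simp add: r_N_coarse_def)
    have pq: "n - 1 < n + 1" "n < n + 1" "n - 1 \<noteq> n"
      using n by auto
    \<comment> \<open>The mirror image: the last row collects half of the entry at n - 1 and all of
      the entry at n.\<close>
    show "(?R *\<^sub>v ?vN) $ i = r_N_coarse n \<theta>\<^sub>2 g\<^sub>b u $ i"
      using i m unfolding two_point[OF i pq] entries[OF i]
      by (auto simp: r_N_coarse_def field_simps)
  qed (simp add: r_N_coarse_def restriction_def)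
  show ?thesis
    unfolding split B P N ..
qed

theorem mainTheorem1:
  fixes n :: nat and \<theta>\<^sub>1 \<theta>\<^sub>2 lam g\<^sub>a g\<^sub>b :: real and f :: "real \<Rightarrow> real" and u :: "real vec"
  assumes "2 \<le> n" and "even n"
    and "0 < \<theta>\<^sub>1" and "\<theta>\<^sub>1 \<le> 1" and "0 < \<theta>\<^sub>2" and "\<theta>\<^sub>2 \<le> 1"
    and "0 < lam"
    and "\<And>i. i \<le> n \<Longrightarrow>
      (\<lambda>x. f x * hat n i x) integrable_on {left_end n \<theta>\<^sub>1<..<right_end n \<theta>\<^sub>2}"
    and "u \<in> carrier_vec (n + 1)"
  shows "split_coarse_residual n \<theta>\<^sub>1 \<theta>\<^sub>2 lam g\<^sub>a g\<^sub>b f u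
    = standard_coarse_residual n \<theta>\<^sub>1 \<theta>\<^sub>2 lam g\<^sub>a g\<^sub>b f u"
proof -
  let ?R = "restriction n" and ?rI = "r_I n \<theta>\<^sub>1 \<theta>\<^sub>2 f u"
    and ?w = "boundary_residual n \<theta>\<^sub>1 \<theta>\<^sub>2 lam g\<^sub>a g\<^sub>b u"
  let ?B = "r_B_coarse n \<theta>\<^sub>1 g\<^sub>a u" and ?P = "r_pen_coarse n \<theta>\<^sub>1 lam g\<^sub>a u"
    and ?N = "r_N_coarse n \<theta>\<^sub>2 g\<^sub>b u"
  have R: "?R \<in> carrier_mat (n div 2 + 1) (n + 1)"
    by (simp add: restriction_def)
  \<comment> \<open>The dimension of the iterated difference is that of its last subtrahend, hence
    only \<open>A_BN\<close> is unfolded.\<close>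
  have rI: "?rI \<in> carrier_vec (n + 1)"
    by (rule carrier_vecI) (simp add: r_I_def A_BN_def)
  have w: "?w \<in> carrier_vec (n + 1)"
    by (simp add: boundary_residual_def)
  have coarse: "?B \<in> carrier_vec (n div 2 + 1)" "?P \<in> carrier_vec (n div 2 + 1)"
    "?N \<in> carrier_vec (n div 2 + 1)"
    by (simp_all add: r_B_coarse_def r_pen_coarse_def r_N_coarse_def)
  have RrI: "?R *\<^sub>v ?rI \<in> carrier_vec (n div 2 + 1)"
    using R rI by simp
  have "standard_coarse_residual n \<theta>\<^sub>1 \<theta>\<^sub>2 lam g\<^sub>a g\<^sub>b f u = ?R *\<^sub>v ?rI + ?R *\<^sub>v ?w"
    unfolding standard_coarse_residual_def
    using assms by (subst fine_residual_eq) (simp_all add: mult_add_distrib_mat_vec[OF R rI w])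
  also have "?R *\<^sub>v ?w = ?B + ?P + ?N"
    using assms(1-6) by (rule restriction_boundary_residual)
  \<comment> \<open>The split residual is a left-nested sum, so only reassociation remains; it needs
    the carrier facts.\<close>
  also have "?R *\<^sub>v ?rI + (?B + ?P + ?N) = split_coarse_residual n \<theta>\<^sub>1 \<theta>\<^sub>2 lam g\<^sub>a g\<^sub>b f u"
    unfolding split_coarse_residual_def using RrI coarse
    by (metis add_carrier_vec assoc_add_vec)
  finally show ?thesis ..
qed

end
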